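(* The equation $xy = yx^{-1}$ (in the two free variables $x,y$) has finite satisfiability gap $\varepsilon = \frac{3}{8}$. That is, for every finite group $G$, either $\mathrm{ds}_G(xy=yx^{-1}) = 1$ or $\mathrm{ds}_G(xy=yx^{-1}) \leq 1 - \frac{3}{8}$.
   Context: For an equation $\varphi$ in the first-order language of group theory with $n$ free variables and a finite group $G$, the degree of satisfiability of $\varphi$ in $G$ is $\mathrm{ds}_G(\varphi) = \frac{|\{\overline{x} \in G^n : \varphi(\overline{x})\}|}{|G^n|}$. The equation $\varphi$ has finite satisfiability gap $\varepsilon > 0$ if for every finite group $G$ either $\mathrm{ds}_G(\varphi) = 1$ or $\mathrm{ds}_G(\varphi) \leq 1-\varepsilon$. *)

theory Defs
  imports Complex_Main "HOL-Library.FuncSet" "HOL-Algebra.Group"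
begin

datatype (term_vars: 'v) group_term =
    GVar 'v
  | GOne
  | GMult "'v group_term" "'v group_term" (infixl \<open>\<cdot>\<^sub>t\<close> 70)
  | GInv "'v group_term"

datatype (free_vars: 'v) group_equation =
  GEq "'v group_term" "'v group_term" (infix \<open>=\<^sub>t\<close> 50)

primrec eval_term :: "('a, 'b) monoid_scheme \<Rightarrow> ('v \<Rightarrow> 'a) \<Rightarrow> 'v group_term \<Rightarrow> 'a" where
  "eval_term G x (GVar v) = x v"
| "eval_term G x GOne = \<one>\<^bsub>G\<^esub>"
| "eval_term G x (s \<cdot>\<^sub>t t) = eval_term G x s \<otimes>\<^bsub>G\<^esub> eval_term G x t"
| "eval_term G x (GInv t) = inv\<^bsub>G\<^esub> (eval_term G x t)"

primrec satisfies :: "('a, 'b) monoid_scheme \<Rightarrow> ('v \<Rightarrow> 'a) \<Rightarrow> 'v group_equation \<Rightarrow> bool" where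
  "satisfies G x (s =\<^sub>t t) \<longleftrightarrow> eval_term G x s = eval_term G x t"

text \<open>The power \<open>G\<^sup>n\<close> is the set of assignments of elements of \<open>G\<close> to the \<open>n\<close> free variables
  of the equation, extensional so that different assignments are different functions.\<close>

definition assignments :: "('a, 'b) monoid_scheme \<Rightarrow> 'v group_equation \<Rightarrow> ('v \<Rightarrow> 'a) set" where
  "assignments G \<phi> = free_vars \<phi> \<rightarrow>\<^sub>E carrier G"

definition degree_of_satisfiability ::
  "('a, 'b) monoid_scheme \<Rightarrow> 'v group_equation \<Rightarrow> real" where
  "degree_of_satisfiability G \<phi> =
     real (card {x \<in> assignments G \<phi>. satisfies G x \<phi>}) / real (card (assignments G \<phi>))"

text \<open>HOL cannot quantify over types inside a formula. The type argument fixes the type in which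
  the groups live; a theorem in which it is left polymorphic covers every finite group.\<close>

definition finite_satisfiability_gap ::
  "('a, 'b) monoid_scheme itself \<Rightarrow> 'v group_equation \<Rightarrow> real \<Rightarrow> bool" where
  "finite_satisfiability_gap T \<phi> \<epsilon> \<longleftrightarrow> \<epsilon> > 0 \<and>
     (\<forall>G :: ('a, 'b) monoid_scheme. group G \<and> finite (carrier G) \<longrightarrow>
        degree_of_satisfiability G \<phi> = 1 \<or> degree_of_satisfiability G \<phi> \<le> 1 - \<epsilon>)"

end

theory Submission
  imports Defs
begin

text \<open>
  The equation \<open>x y = y x\<inverse>\<close> says that \<open>y\<close> conjugates \<open>x\<close> to its inverse. For a fixed \<open>x\<close> the
  set of such \<open>y\<close> is either empty or a coset of the centralizer of \<open>x\<close>. Hence it is all of the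
  group exactly when \<open>x\<close> is central with \<open>x\<^sup>2 = 1\<close>, and otherwise it makes up at most half of the
  group, because a proper subgroup has index at least two.

  Let \<open>Z\<close> be the center and \<open>K\<close> the subgroup of those \<open>x \<in> Z\<close> with \<open>x\<^sup>2 = 1\<close>.
  If \<open>G\<close> is not abelian, then \<open>Z\<close> lies properly in the centralizer of any noncentral element,
  which is itself proper, so \<open>|K| \<le> |Z| \<le> |G|/4\<close>, and summing over \<open>x\<close> bounds the
  density of solutions by \<open>1/4 + (3/4)(1/2) = 5/8\<close>. If \<open>G\<close> is abelian, only the \<open>x \<in> K\<close> have
  any \<open>y\<close> at all, so the density is \<open>|K|/|G|\<close>, which is \<open>1\<close> or at most \<open>1/2\<close>.
\<close>

section \<open>Centralizers, the center and its square roots of one\<close>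

context group
begin

definition centralizer_of :: "'a \<Rightarrow> 'a set" where
  "centralizer_of a = {y \<in> carrier G. a \<otimes> y = y \<otimes> a}"

definition center :: "'a set" where
  "center = {a \<in> carrier G. \<forall>y \<in> carrier G. a \<otimes> y = y \<otimes> a}"

definition central_square_roots_of_one :: "'a set" where
  "central_square_roots_of_one = {a \<in> center. a \<otimes> a = \<one>}"

definition inverting_elements :: "'a \<Rightarrow> 'a set" where
  "inverting_elements a = {y \<in> carrier G. a \<otimes> y = y \<otimes> inv a}"

lemma inv_mult_cancel_left:
  assumes "a \<in> carrier G" "b \<in> carrier G"
  shows "inv a \<otimes> (a \<otimes> b) = b"
  using assms by (simp flip: m_assoc)

lemma subgroup_centralizer_of:
  assumes a: "a \<in> carrier G"
  shows "subgroup (centralizer_of a) G"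
proof (rule subgroupI)
  show "centralizer_of a \<subseteq> carrier G" "centralizer_of a \<noteq> {}"
    using a by (auto simp: centralizer_of_def)
next
  fix y assume "y \<in> centralizer_of a"
  then have y: "y \<in> carrier G" "a \<otimes> y = y \<otimes> a" by (auto simp: centralizer_of_def)
  have "inv y \<otimes> (a \<otimes> y) \<otimes> inv y = inv y \<otimes> (y \<otimes> a) \<otimes> inv y" by (simp add: y(2))
  then have "inv y \<otimes> a = a \<otimes> inv y"
    using a y(1) by (simp add: m_assoc inv_mult_cancel_left)
  then show "inv y \<in> centralizer_of a" using y(1) by (simp add: centralizer_of_def)
next
  fix y z assume "y \<in> centralizer_of a" "z \<in> centralizer_of a"
  then have y: "y \<in> carrier G" "a \<otimes> y = y \<otimes> a" and z: "z \<in> carrier G" "a \<otimes> z = z \<otimes> a"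
    by (auto simp: centralizer_of_def)
  have "a \<otimes> (y \<otimes> z) = y \<otimes> (a \<otimes> z)" using a y z(1) by (simp flip: m_assoc)
  then show "y \<otimes> z \<in> centralizer_of a"
    using a y(1) z by (simp add: centralizer_of_def m_assoc)
qed

lemma center_commute:
  assumes "a \<in> center" "y \<in> carrier G"
  shows "a \<otimes> y = y \<otimes> a"
  using assms by (simp add: center_def)

lemma subgroup_center: "subgroup center G"
proof -
  have "center = (\<Inter>a \<in> carrier G. centralizer_of a)"
    by (auto simp: center_def centralizer_of_def)
  moreover have "subgroup (\<Inter>a \<in> carrier G. centralizer_of a) G"
    by (rule subgroups_Inter) (auto intro: subgroup_centralizer_of)
  ultimately show ?thesis by simp
qed

lemma subgroup_central_square_roots_of_one: "subgroup central_square_roots_of_one G"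
proof (rule subgroupI)
  show "central_square_roots_of_one \<subseteq> carrier G"
    by (auto simp: central_square_roots_of_one_def center_def)
  show "central_square_roots_of_one \<noteq> {}"
    by (auto simp: central_square_roots_of_one_def center_def intro!: exI[of _ \<one>])
next
  fix a assume "a \<in> central_square_roots_of_one"
  then have a: "a \<in> center" "a \<in> carrier G" "a \<otimes> a = \<one>"
    by (auto simp: central_square_roots_of_one_def center_def)
  have "inv a = a" using a by (intro inv_equality)
  with a show "inv a \<in> central_square_roots_of_one"
    by (simp add: central_square_roots_of_one_def)
next
  fix a b assume "a \<in> central_square_roots_of_one" "b \<in> central_square_roots_of_one"
  then have a: "a \<in> center" "a \<in> carrier G" "a \<otimes> a = \<one>"
    and b: "b \<in> center" "b \<in> carrier G" "b \<otimes> b = \<one>"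
    by (auto simp: central_square_roots_of_one_def center_def)
  have comm: "b \<otimes> a = a \<otimes> b" using center_commute[OF b(1) a(2)] .
  have "a \<otimes> b \<otimes> (a \<otimes> b) = a \<otimes> (b \<otimes> a) \<otimes> b" using a(2) b(2) by (simp add: m_assoc)
  also have "\<dots> = (a \<otimes> a) \<otimes> (b \<otimes> b)"
    unfolding comm using a(2) b(2) by (simp only: m_assoc m_closed)
  finally have "a \<otimes> b \<otimes> (a \<otimes> b) = \<one>" using a(3) b(3) by simp
  then show "a \<otimes> b \<in> central_square_roots_of_one"
    using a b subgroup.m_closed[OF subgroup_center] by (simp add: central_square_roots_of_one_def)
qed

section \<open>Index bounds for proper subgroups\<close>

text \<open>A translate of \<open>H\<close> by an element of \<open>K\<close> outside \<open>H\<close> still fits into \<open>K\<close>, next to \<open>H\<close>.\<close>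

lemma double_card_proper_subgroup_le:
  assumes H: "subgroup H G" and K: "subgroup K G" and "H \<subset> K" and fin: "finite K"
  shows "2 * card H \<le> card K"
proof -
  obtain g where g: "g \<in> K" "g \<notin> H" using \<open>H \<subset> K\<close> by blast
  have HG: "H \<subseteq> carrier G" using subgroup.subset[OF H] .
  have gG: "g \<in> carrier G" using g(1) subgroup.subset[OF K] by blast
  have disj: "H \<inter> (\<lambda>h. g \<otimes> h) ` H = {}"
  proof (rule ccontr)
    assume "H \<inter> (\<lambda>h. g \<otimes> h) ` H \<noteq> {}"
    then obtain h where h: "h \<in> H" "g \<otimes> h \<in> H" by blast
    then have "g \<otimes> h \<otimes> inv h \<in> H"
      using subgroup.m_closed[OF H] subgroup.m_inv_closed[OF H] by blast
    moreover have "g \<otimes> h \<otimes> inv h = g" using h(1) HG gG by (auto simp: m_assoc)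
    ultimately show False using g(2) by simp
  qed
  have "inj_on (\<lambda>h. g \<otimes> h) H" using HG gG by (auto intro!: inj_onI simp: subset_iff)
  then have "2 * card H = card H + card ((\<lambda>h. g \<otimes> h) ` H)" by (simp add: card_image)
  also have "\<dots> = card (H \<union> (\<lambda>h. g \<otimes> h) ` H)"
    using finite_subset[OF _ fin] \<open>H \<subset> K\<close> disj by (subst card_Un_disjoint) auto
  also have "\<dots> \<le> card K"
    using g(1) \<open>H \<subset> K\<close> subgroup.m_closed[OF K] by (intro card_mono fin) blast
  finally show ?thesis .
qed

text \<open>The centralizer of the noncentral \<open>a\<close> lies strictly between the center and the group.\<close>

lemma four_card_center_le:
  assumes fin: "finite (carrier G)" and a: "a \<in> carrier G" "a \<notin> center"
  shows "4 * card center \<le> card (carrier G)"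
proof -
  have "center \<subset> centralizer_of a"
    using a by (auto simp: center_def centralizer_of_def)
  then have "2 * card center \<le> card (centralizer_of a)"
    using subgroup_center subgroup_centralizer_of[OF a(1)]
      finite_subset[OF subgroup.subset[OF subgroup_centralizer_of[OF a(1)]] fin]
    by (intro double_card_proper_subgroup_le)
  moreover have "centralizer_of a \<subset> carrier G"
    using a by (auto simp: center_def centralizer_of_def)
  then have "2 * card (centralizer_of a) \<le> card (carrier G)"
    using subgroup_self subgroup_centralizer_of[OF a(1)] fin
    by (intro double_card_proper_subgroup_le)
  ultimately show ?thesis by linarith
qed

section \<open>Elements inverting a fixed element\<close>

text \<open>If \<open>y\<close> and \<open>z\<close> both invert \<open>a\<close>, then \<open>y z\<inverse>\<close> commutes with \<open>a\<close>.\<close>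

lemma card_inverting_elements_le:
  assumes fin: "finite (carrier G)" and a: "a \<in> carrier G"
  shows "card (inverting_elements a) \<le> card (centralizer_of a)"
proof (cases "inverting_elements a = {}")
  case False
  then obtain z where z: "z \<in> carrier G" "a \<otimes> z = z \<otimes> inv a"
    by (auto simp: inverting_elements_def)
  have inv_z: "inv a \<otimes> inv z = inv z \<otimes> a"
  proof -
    have "inv (a \<otimes> z) = inv (z \<otimes> inv a)" using z(2) by simp
    then have "inv z \<otimes> inv a = a \<otimes> inv z" using a z(1) by (simp add: inv_mult_group)
    then have "inv a \<otimes> (inv z \<otimes> inv a) \<otimes> a = inv a \<otimes> (a \<otimes> inv z) \<otimes> a" by simp
    then show ?thesis using a z(1) by (simp add: m_assoc inv_mult_cancel_left)
  qed
  have "y \<otimes> inv z \<in> centralizer_of a" if "y \<in> inverting_elements a" for y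
  proof -
    have y: "y \<in> carrier G" "a \<otimes> y = y \<otimes> inv a"
      using that by (auto simp: inverting_elements_def)
    have "a \<otimes> (y \<otimes> inv z) = y \<otimes> (inv a \<otimes> inv z)"
      using a y z(1) by (simp add: m_assoc[symmetric])
    then show ?thesis using a y(1) z(1) inv_z by (simp add: centralizer_of_def m_assoc)
  qed
  moreover have "inj_on (\<lambda>y. y \<otimes> inv z) (inverting_elements a)"
    using z(1) by (auto simp: inj_on_def inverting_elements_def)
  moreover have "finite (centralizer_of a)"
    using fin by (simp add: centralizer_of_def)
  ultimately show ?thesis
    by (meson card_inj_on_le image_subsetI)
qed simp

lemma inverting_elements_central_square_root_of_one:
  assumes "a \<in> central_square_roots_of_one"
  shows "inverting_elements a = carrier G"
proof -
  have a: "a \<in> center" "a \<in> carrier G" "a \<otimes> a = \<one>"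
    using assms by (auto simp: central_square_roots_of_one_def center_def)
  have "inv a = a" using a by (intro inv_equality)
  then show ?thesis using center_commute[OF a(1)] by (auto simp: inverting_elements_def)
qed

text \<open>A central \<open>a\<close> is fixed by conjugation, so inverting it would force \<open>a\<inverse> = a\<close>.\<close>

lemma inverting_elements_central_eq_empty:
  assumes "a \<in> center" "a \<notin> central_square_roots_of_one"
  shows "inverting_elements a = {}"
proof (rule ccontr)
  assume "inverting_elements a \<noteq> {}"
  then obtain y where y: "y \<in> carrier G" "a \<otimes> y = y \<otimes> inv a"
    by (auto simp: inverting_elements_def)
  have a: "a \<in> carrier G" using assms(1) by (simp add: center_def)
  have "y \<otimes> a = y \<otimes> inv a" using center_commute[OF assms(1) y(1)] y(2) by simp
  then have "inv a = a" using a y(1) by simp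
  then have "a \<otimes> a = \<one>" using r_inv[OF a] by simp
  then show False using assms by (simp add: central_square_roots_of_one_def)
qed

lemma double_card_inverting_elements_le:
  assumes fin: "finite (carrier G)" and a: "a \<in> carrier G" "a \<notin> central_square_roots_of_one"
  shows "2 * card (inverting_elements a) \<le> card (carrier G)"
proof (cases "a \<in> center")
  case True
  then show ?thesis using inverting_elements_central_eq_empty a by simp
next
  case False
  then have "centralizer_of a \<subset> carrier G"
    using a by (auto simp: center_def centralizer_of_def)
  then have "2 * card (centralizer_of a) \<le> card (carrier G)"
    using subgroup_self subgroup_centralizer_of[OF a(1)] fin
    by (intro double_card_proper_subgroup_le)
  then show ?thesis using card_inverting_elements_le[OF fin a(1)] by linarith
qed

section \<open>Counting solutions\<close>

text \<open>
  With \<open>g = |G|\<close> and \<open>k = |K|\<close> for the set \<open>K\<close> of central square roots of one, the nonabelian case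
  is \<open>2 \<Sum> \<le> 2 k g + (g - k) g = k g + g\<^sup>2\<close> together with \<open>4 k \<le> g\<close>. The abelian case needs the
  sharper fact that elements outside \<open>K\<close> contribute nothing, as \<open>k = g / 2\<close> is possible there.
\<close>

lemma sum_card_inverting_elements_le:
  assumes fin: "finite (carrier G)" and proper: "central_square_roots_of_one \<noteq> carrier G"
  shows "8 * (\<Sum>a \<in> carrier G. card (inverting_elements a)) \<le> 5 * (card (carrier G))\<^sup>2"
proof -
  define K where "K = central_square_roots_of_one"
  define g where "g = card (carrier G)"
  define S where "S = (\<Sum>a \<in> carrier G. card (inverting_elements a))"
  have K: "K \<subset> carrier G"
    using subgroup.subset[OF subgroup_central_square_roots_of_one] proper by (auto simp: K_def)
  have finK: "finite K" using K fin finite_subset by blast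
  have split: "S = card K * g + (\<Sum>a \<in> carrier G - K. card (inverting_elements a))"
  proof -
    have "(\<Sum>a \<in> K. card (inverting_elements a)) = card K * g"
      by (simp add: K_def g_def inverting_elements_central_square_root_of_one)
    then show ?thesis
      using sum.subset_diff[of K "carrier G" "\<lambda>a. card (inverting_elements a)"] K fin
      by (simp add: S_def)
  qed
  have "8 * S \<le> 5 * (g * g)"
  proof (cases "center = carrier G")
    case True
    have "(\<Sum>a \<in> carrier G - K. card (inverting_elements a)) = 0"
      using inverting_elements_central_eq_empty True by (simp add: K_def)
    then have "S = card K * g" using split by simp
    moreover have "2 * card K \<le> g"
      using double_card_proper_subgroup_le[OF subgroup_central_square_roots_of_one subgroup_self]
        K fin by (simp add: K_def g_def)
    then have "2 * card K * g \<le> g * g" by (rule mult_le_mono1)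
    ultimately show ?thesis by linarith
  next
    case False
    then obtain a where a: "a \<in> carrier G" "a \<notin> center" by (auto simp: center_def)
    have "card K \<le> card center"
      using fin by (intro card_mono) (auto simp: K_def central_square_roots_of_one_def center_def)
    then have "4 * card K \<le> g"
      using four_card_center_le[OF fin a] by (simp add: g_def)
    then have quarter: "4 * card K * g \<le> g * g" by (rule mult_le_mono1)
    have "2 * (\<Sum>a \<in> carrier G - K. card (inverting_elements a))
        = (\<Sum>a \<in> carrier G - K. 2 * card (inverting_elements a))"
      by (simp add: sum_distrib_left)
    also have "\<dots> \<le> (\<Sum>a \<in> carrier G - K. g)"
      using double_card_inverting_elements_le fin by (intro sum_mono) (simp add: K_def g_def)
    also have "\<dots> = (g - card K) * g"
      using K finK by (simp add: g_def card_Diff_subset)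
    finally have rest: "2 * (\<Sum>a \<in> carrier G - K. card (inverting_elements a)) \<le> (g - card K) * g" .
    have "card K \<le> g" using K fin by (simp add: g_def card_mono)
    then have "(g - card K) * g + card K * g = g * g"
      by (simp add: add_mult_distrib[symmetric])
    with rest split quarter show ?thesis by linarith
  qed
  then show ?thesis by (simp add: S_def g_def power2_eq_square)
qed

lemma degree_of_satisfiability_inverting:
  assumes fin: "finite (carrier G)" and "x \<noteq> y"
  shows "degree_of_satisfiability G (GVar x \<cdot>\<^sub>t GVar y =\<^sub>t GVar y \<cdot>\<^sub>t GInv (GVar x))
    = real (\<Sum>a \<in> carrier G. card (inverting_elements a)) / real ((card (carrier G))\<^sup>2)"
proof -
  let ?\<phi> = "GVar x \<cdot>\<^sub>t GVar y =\<^sub>t GVar y \<cdot>\<^sub>t GInv (GVar x)"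
  have A: "assignments G ?\<phi> = {x, y} \<rightarrow>\<^sub>E carrier G"
    by (auto simp: assignments_def insert_commute)
  have cardA: "card (assignments G ?\<phi>) = (card (carrier G))\<^sup>2"
    unfolding A using \<open>x \<noteq> y\<close> by (simp add: card_PiE power2_eq_square)
  have "bij_betw (\<lambda>f. (f x, f y)) {f \<in> assignments G ?\<phi>. satisfies G f ?\<phi>}
      (Sigma (carrier G) inverting_elements)"
  (* The inverse map takes the value undefined off {x, y}, as extensional assignments do. *)
  proof (rule bij_betw_byWitness[where
        f' = "\<lambda>(a, b) v. if v = x then a else if v = y then b else undefined"])
    show "\<forall>f \<in> {f \<in> assignments G ?\<phi>. satisfies G f ?\<phi>}.
        (case (f x, f y) of (a, b) \<Rightarrow> \<lambda>v. if v = x then a else if v = y then b else undefined) = f"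
      unfolding A by (auto simp: fun_eq_iff PiE_def extensional_def)
  qed (use \<open>x \<noteq> y\<close> in \<open>auto simp: A inverting_elements_def PiE_def extensional_def\<close>)
  then have "card {f \<in> assignments G ?\<phi>. satisfies G f ?\<phi>}
      = card (Sigma (carrier G) inverting_elements)"
    by (rule bij_betw_same_card)
  also have "\<dots> = (\<Sum>a \<in> carrier G. card (inverting_elements a))"
    using fin by (intro card_SigmaI) (auto simp: inverting_elements_def)
  finally show ?thesis by (simp add: degree_of_satisfiability_def cardA)
qed

end

theorem proposition2p13:
  fixes x y :: 'v
  assumes "x \<noteq> y"
  shows "finite_satisfiability_gap TYPE(('a, 'b) monoid_scheme)
           (GVar x \<cdot>\<^sub>t GVar y =\<^sub>t GVar y \<cdot>\<^sub>t GInv (GVar x)) (3 / 8)"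
  unfolding finite_satisfiability_gap_def
proof (intro conjI allI impI)
  fix G :: "('a, 'b) monoid_scheme"
  assume G: "group G \<and> finite (carrier G)"
  then interpret group G by simp
  have fin: "finite (carrier G)" using G by simp
  let ?\<phi> = "GVar x \<cdot>\<^sub>t GVar y =\<^sub>t GVar y \<cdot>\<^sub>t GInv (GVar x)"
  note ds = degree_of_satisfiability_inverting[OF fin assms]
  have pos: "card (carrier G) > 0" using fin one_closed by (auto simp: card_gt_0_iff)
  show "degree_of_satisfiability G ?\<phi> = 1 \<or> degree_of_satisfiability G ?\<phi> \<le> 1 - 3 / 8"
  proof (cases "central_square_roots_of_one = carrier G")
    case True
    then have "(\<Sum>a \<in> carrier G. card (inverting_elements a)) = (card (carrier G))\<^sup>2"
      by (simp add: inverting_elements_central_square_root_of_one power2_eq_square)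
    then show ?thesis using pos unfolding ds by simp
  next
    case False
    then have "real (8 * (\<Sum>a \<in> carrier G. card (inverting_elements a)))
        \<le> real (5 * (card (carrier G))\<^sup>2)"
      using sum_card_inverting_elements_le[OF fin False] by (simp only: of_nat_le_iff)
    then show ?thesis using pos unfolding ds by (simp add: divide_le_eq)
  qed
qed simp

end
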